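(* Let $E\subseteq\mathbb{T}$ be a closed set with $\operatorname{Cap}(E)>0$. Then $$\lim_{r\to1^-}\operatorname{Cap}\bigl(E,\overline{\Delta}(0,r)\bigr)=+\infty .$$
   Context: $\Delta$ is the open unit disc in $\mathbb{C}$, $\mathbb{T}=\partial\Delta$ is the unit circle, $\overline{\Delta}=\Delta\cup\mathbb{T}$, and $\overline{\Delta}(z,r)$ is the closed disc of radius $r$ centered at $z$. For closed disjoint sets $E,F\subset\overline{\Delta}$, the capacity of the condenser $(E,F)$ in $\Delta$ is $$\operatorname{Cap}(E,F)=\inf\left\{\|\nabla u\|_{L^2(\Delta)}^2:\ u\ge1\text{ on }E,\ u\le0\text{ on }F\right\},$$ where the infimum is over real functions $u$ which are $C^1$ in $\Delta$ and such that, for each $\zeta\in(E\cup F)\setminus\Delta$, the limit $\lim_{r\to1^-}u(r\zeta)\in\mathbb{R}\cup\{+\infty\}$ exists; the value of $u$ at such a boundary point $\zeta$ is understood to be this limit. The $L^2(\Delta)$ norm is with respect to area measure. For closed $E\subseteq\mathbb{T}$ one sets $\operatorname{Cap}(E):=\operatorname{Cap}(E,\overline{\Delta}(0,1/2))$. *)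

theory Defs
  imports "HOL-Analysis.Analysis"
begin

definition grad :: "(complex \<Rightarrow> real) \<Rightarrow> complex \<Rightarrow> complex" where
  "grad u z = (THE D. GDERIV u z :> D)"

definition C1_on :: "complex set \<Rightarrow> (complex \<Rightarrow> real) \<Rightarrow> bool" where
  "C1_on S u \<longleftrightarrow> (\<forall>z\<in>S. \<exists>D. GDERIV u z :> D) \<and> continuous_on S (grad u)"

definition dirichlet_energy :: "(complex \<Rightarrow> real) \<Rightarrow> ennreal" where
  "dirichlet_energy u = (\<integral>\<^sup>+z\<in>ball 0 1. ennreal ((norm (grad u z))\<^sup>2) \<partial>lborel)"

definition has_radial_limit :: "(complex \<Rightarrow> real) \<Rightarrow> complex \<Rightarrow> ereal \<Rightarrow> bool" where
  "has_radial_limit u \<zeta> L \<longleftrightarrow>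
     ((\<lambda>r. ereal (u (complex_of_real r * \<zeta>))) \<longlongrightarrow> L) (at_left 1)"

text \<open>Outside the open disc the function values of \<open>u\<close> are ignored: there the value is the
  radial limit (unique when it exists, which \<open>admissible\<close> below demands on \<open>E \<union> F\<close>).\<close>

definition disc_value :: "(complex \<Rightarrow> real) \<Rightarrow> complex \<Rightarrow> ereal" where
  "disc_value u \<zeta> =
     (if \<zeta> \<in> ball 0 1 then ereal (u \<zeta>) else (THE L. has_radial_limit u \<zeta> L))"

definition admissible :: "complex set \<Rightarrow> complex set \<Rightarrow> (complex \<Rightarrow> real) \<Rightarrow> bool" where
  "admissible E F u \<longleftrightarrow>
     C1_on (ball 0 1) u \<and>
     (\<forall>\<zeta>\<in>(E \<union> F) - ball 0 1. \<exists>L. L \<noteq> -\<infinity> \<and> has_radial_limit u \<zeta> L) \<and>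
     (\<forall>z\<in>E. disc_value u z \<ge> 1) \<and>
     (\<forall>z\<in>F. disc_value u z \<le> 0)"

text \<open>Meaningful for disjoint closed subsets \<open>E\<close>, \<open>F\<close> of \<open>cball 0 1\<close>. The infimum is taken in
  \<open>[0, \<infinity>]\<close>, so functions of infinite energy are harmless and the infimum of the empty set
  is \<open>\<infinity>\<close>.\<close>

definition condenser_cap :: "complex set \<Rightarrow> complex set \<Rightarrow> ennreal" where
  "condenser_cap E F = (INF u\<in>{u. admissible E F u}. dirichlet_energy u)"

definition circle_cap :: "complex set \<Rightarrow> ennreal" where
  "circle_cap E = condenser_cap E (cball 0 (1/2))"

end

theory Submission
  imports Defs
begin

text \<open>If the capacities stay bounded by \<open>M\<close>, each disc \<open>cball 0 r\<close> carries a competitor of energy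
  at most \<open>M + 1\<close>. After a smooth truncation it vanishes, together with its gradient, on
  \<open>cball 0 r\<close>. Choosing the radii successively so close to \<open>1\<close> that the sum of the previous
  functions has little energy outside \<open>cball 0 r\<close>, the gradients become almost orthogonal:
  the sum of \<open>N\<close> such functions has energy \<open>O(N)\<close>, so their average has energy \<open>O(1/N)\<close>,
  which forces \<open>circle_cap E = 0\<close>.\<close>

section \<open>Gradients and continuously differentiable functions\<close>

lemma GDERIV_unique:
  assumes "GDERIV u z :> D" "GDERIV u z :> D'"
  shows "D = D'"
proof -
  have "(\<lambda>h. inner h D) = (\<lambda>h. inner h D')"
    using assms unfolding gderiv_def by (rule has_derivative_unique)
  then show ?thesis by (simp only: fun_eq_iff vector_eq_ldot)
qed

lemma grad_eq: "GDERIV u z :> D \<Longrightarrow> grad u z = D"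
  unfolding grad_def by (rule the_equality) (auto intro: GDERIV_unique)

lemma C1_on_GDERIV: "C1_on S u \<Longrightarrow> z \<in> S \<Longrightarrow> GDERIV u z :> grad u z"
  unfolding C1_on_def using grad_eq by metis

text \<open>By uniqueness, an explicit gradient field agrees on \<open>S\<close> with the
  description operator inside \<open>grad\<close>, so continuity can be checked on an explicit
  formula.\<close>

lemma C1_onI:
  assumes "\<And>z. z \<in> S \<Longrightarrow> GDERIV u z :> g z" "continuous_on S g"
  shows "C1_on S u"
  using assms grad_eq unfolding C1_on_def by (metis (no_types, lifting) continuous_on_cong)

lemma C1_on_continuous: "C1_on S u \<Longrightarrow> continuous_on S u"
  by (meson C1_on_GDERIV continuous_at_imp_continuous_on gderiv_def has_derivative_continuous)

lemma GDERIV_compose_DERIV: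
  assumes "GDERIV u z :> D" "DERIV f (u z) :> d"
  shows "GDERIV (\<lambda>x. f (u x)) z :> d *\<^sub>R D"
  using GDERIV_DERIV_compose[OF assms] .

lemma C1_on_compose_DERIV:
  assumes "C1_on S u" "\<And>t. DERIV f t :> f' t" "continuous_on UNIV f'"
  shows "C1_on S (\<lambda>z. f (u z))"
proof (rule C1_onI)
  show "GDERIV (\<lambda>z. f (u z)) z :> f' (u z) *\<^sub>R grad u z" if "z \<in> S" for z
    using GDERIV_compose_DERIV C1_on_GDERIV[OF assms(1) that] assms(2) by blast
  show "continuous_on S (\<lambda>z. f' (u z) *\<^sub>R grad u z)"
    using assms C1_on_continuous[OF assms(1)] unfolding C1_on_def
    by (intro continuous_intros continuous_on_compose2[OF assms(3)]) auto
qed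

lemma C1_on_add:
  assumes "C1_on S u" "C1_on S v"
  shows "C1_on S (\<lambda>z. u z + v z)"
  by (rule C1_onI[where g = "\<lambda>z. grad u z + grad v z"])
    (use assms in \<open>auto intro!: GDERIV_add C1_on_GDERIV continuous_intros simp: C1_on_def\<close>)

lemma C1_on_scale:
  assumes "C1_on S u"
  shows "C1_on S (\<lambda>z. c * u z)"
  by (rule C1_on_compose_DERIV[OF assms, where f = "\<lambda>t. c * t" and f' = "\<lambda>_. c"])
    (auto intro!: derivative_eq_intros continuous_intros)

section \<open>A continuously differentiable truncation\<close>

lemma DERIV_mult_pos_part: "DERIV (\<lambda>t::real. t * max 0 t) x :> 2 * max 0 x"
proof (cases x "0::real" rule: linorder_cases)
  case less
  have "DERIV (\<lambda>t::real. 0) x :> 2 * max 0 x" using less by (auto simp: max_def)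
  then show ?thesis
    by (rule DERIV_cong_ev[THEN iffD1, OF refl _ refl, rotated])
      (use less in \<open>auto intro!: eventually_mono[OF eventually_nhds_in_open[of "{..<0}"]]\<close>)
next
  case equal
  \<comment> \<open>Only at the knot is the difference quotient needed: there it is
    \<open>max 0 h\<close>, which tends to 0.\<close>
  have "((\<lambda>h::real. max 0 h) \<longlongrightarrow> max 0 0) (at 0)" by (intro tendsto_intros)
  then have "((\<lambda>h::real. max 0 h) \<longlongrightarrow> 0) (at 0)" by simp
  moreover have "\<forall>\<^sub>F h::real in at 0. max 0 h = (h * max 0 h) / h"
    by (auto simp: eventually_at_filter)
  ultimately have "((\<lambda>h::real. (h * max 0 h) / h) \<longlongrightarrow> 0) (at 0)"
    by (rule Lim_transform_eventually)
  then show ?thesis using equal by (simp add: DERIV_def)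
next
  case greater
  have "DERIV (\<lambda>t::real. t * t) x :> 2 * max 0 x"
    using greater by (auto intro!: derivative_eq_intros)
  then show ?thesis
    by (rule DERIV_cong_ev[THEN iffD1, OF refl _ refl, rotated])
      (use greater in \<open>auto intro!: eventually_mono[OF eventually_nhds_in_open[of "{0<..}"]]\<close>)
qed

text \<open>Truncating with \<open>max 0\<close> would lose differentiability; this quadratic spline with knots
  \<open>0\<close>, \<open>1/2\<close>, \<open>1\<close> keeps competitors \<open>C\<^sup>1\<close>.\<close>

definition smooth_step :: "real \<Rightarrow> real" where
  "smooth_step t = 2 * (t * max 0 t - 2 * ((t - 1/2) * max 0 (t - 1/2)) + (t - 1) * max 0 (t - 1))"

text \<open>This is the tent function supported on the interval from 0 to 1, with peak value 2 at
  1/2.\<close>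

definition smooth_step' :: "real \<Rightarrow> real" where
  "smooth_step' t = 4 * (max 0 t - 2 * max 0 (t - 1/2) + max 0 (t - 1))"

lemma DERIV_smooth_step: "DERIV smooth_step t :> smooth_step' t"
proof -
  have shift: "DERIV (\<lambda>s. (s - c) * max 0 (s - c)) t :> 2 * max 0 (t - c)" for c
  proof -
    have "DERIV (\<lambda>s. s - c) t :> 1" by (auto intro!: derivative_eq_intros)
    from DERIV_chain2[OF DERIV_mult_pos_part this] show ?thesis by simp
  qed
  show ?thesis
    unfolding smooth_step_def[abs_def] smooth_step'_def
    by (rule derivative_eq_intros DERIV_mult_pos_part shift refl)+ simp
qed

lemma continuous_on_smooth_step': "continuous_on S smooth_step'"
  unfolding smooth_step'_def[abs_def] by (intro continuous_intros)

lemma smooth_step_nonpos: "t \<le> 0 \<Longrightarrow> smooth_step t = 0"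
  by (auto simp: smooth_step_def max_def)

lemma smooth_step'_nonpos: "t \<le> 0 \<Longrightarrow> smooth_step' t = 0"
  by (auto simp: smooth_step'_def max_def)

lemma smooth_step_ge_1: "t \<ge> 1 \<Longrightarrow> smooth_step t = 1"
  by (auto simp: smooth_step_def max_def algebra_simps)

lemma abs_smooth_step'_le: "\<bar>smooth_step' t\<bar> \<le> 2"
  by (auto simp: smooth_step'_def max_def)

text \<open>The limit \<open>L\<close> may be infinite, where continuity of
  \<open>smooth_step\<close> says nothing. Capping the argument at 1 makes the limit real and
  changes no value, since \<open>smooth_step\<close> is constant from 1 on.\<close>

lemma tendsto_smooth_step:
  assumes "((\<lambda>x. ereal (f x)) \<longlongrightarrow> L) F" "L \<ge> 1"
  shows "((\<lambda>x. smooth_step (f x)) \<longlongrightarrow> 1) F"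
proof -
  have "((\<lambda>x. min (ereal (f x)) 1) \<longlongrightarrow> min L 1) F"
    using assms by (intro tendsto_min tendsto_const)
  moreover have "min (ereal (f x)) 1 = ereal (min (f x) 1)" for x
    by (simp add: one_ereal_def min_def)
  ultimately have "((\<lambda>x. min (f x) 1) \<longlongrightarrow> 1) F"
    using assms(2) by (simp add: min_absorb2 one_ereal_def del: ereal_min)
  moreover have "isCont smooth_step 1" using DERIV_smooth_step by (rule DERIV_isCont)
  ultimately have "((\<lambda>x. smooth_step (min (f x) 1)) \<longlongrightarrow> smooth_step 1) F"
    by (metis isCont_tendsto_compose)
  moreover have "smooth_step (min t 1) = smooth_step t" for t
    by (simp add: min_def smooth_step_ge_1)
  ultimately show ?thesis by (simp add: smooth_step_ge_1)
qed

section \<open>Boundary values and monotonicity of the capacity\<close>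

lemma disc_value_eq:
  assumes "has_radial_limit u \<zeta> L" "\<zeta> \<notin> ball 0 1"
  shows "disc_value u \<zeta> = L"
  using assms unfolding disc_value_def has_radial_limit_def
  by (auto intro!: the_equality tendsto_unique[of "at_left (1::real)"])

lemma condenser_cap_mono:
  assumes "F \<subseteq> G"
  shows "condenser_cap E F \<le> condenser_cap E G"
proof -
  have "{u. admissible E G u} \<subseteq> {u. admissible E F u}"
    using assms unfolding admissible_def by blast
  then show ?thesis unfolding condenser_cap_def by (rule INF_superset_mono) simp
qed

section \<open>Estimates of the Dirichlet energy\<close>

lemma borel_measurable_energy_density:
  assumes "C1_on (ball 0 1) u"
  shows "(\<lambda>z. ennreal ((norm (grad u z))\<^sup>2) * indicator (ball 0 1) z) \<in> borel_measurable lborel"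
proof -
  \<comment> \<open>Nothing is known about \<open>grad u\<close> off the open disc, so it is first
    extended by zero.\<close>
  have "(\<lambda>z. indicator (ball 0 1) z *\<^sub>R grad u z) \<in> borel_measurable borel"
    using assms unfolding C1_on_def by (intro borel_measurable_continuous_on_indicator) auto
  then have "(\<lambda>z. ennreal ((norm (indicator (ball 0 1) z *\<^sub>R grad u z))\<^sup>2)) \<in> borel_measurable lborel"
    by measurable
  also have "(\<lambda>z. ennreal ((norm (indicator (ball 0 1) z *\<^sub>R grad u z))\<^sup>2))
      = (\<lambda>z. ennreal ((norm (grad u z))\<^sup>2) * indicator (ball 0 1) z)"
    by (auto simp: fun_eq_iff indicator_def)
  finally show ?thesis .
qed

text \<open>Dominated convergence, with the integrable energy density as majorant of its own tails.
  The bound \<open>1/2 \<le> r\<close> ensures that a function vanishing on \<open>cball 0 r\<close>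
  also vanishes on the disc used in \<open>circle_cap\<close>.\<close>

lemma energy_tail_small:
  assumes "C1_on (ball 0 1) w" "dirichlet_energy w < \<infinity>"
  obtains r where "1/2 \<le> r" "r < 1"
    "(\<integral>\<^sup>+z. ennreal ((norm (grad w z))\<^sup>2) * indicator (ball 0 1) z * indicator (- cball 0 r) z \<partial>lborel) \<le> 1"
proof -
  define f where "f z = ennreal ((norm (grad w z))\<^sup>2) * indicator (ball 0 1) z" for z
  \<comment> \<open>The double successor makes the radii start at 1/2.\<close>
  define s where "s n = 1 + - inverse (real (Suc (Suc n)))" for n
  have f: "f \<in> borel_measurable lborel"
    unfolding f_def by (rule borel_measurable_energy_density) fact
  have s: "s \<longlonglongrightarrow> 1" unfolding s_def by (rule LIMSEQ_Suc[OF LIMSEQ_inverse_real_of_nat_add_minus])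
  have "(\<lambda>n. \<integral>\<^sup>+z. f z * indicator (- cball 0 (s n)) z \<partial>lborel) \<longlonglongrightarrow> (\<integral>\<^sup>+z. 0 \<partial>(lborel :: complex measure))"
  proof (rule nn_integral_dominated_convergence[where w = f])
    show "f \<in> borel_measurable lborel" by fact
    show "(\<integral>\<^sup>+z. f z \<partial>lborel) < \<infinity>"
      using assms(2) unfolding f_def dirichlet_energy_def .
    show "(\<lambda>z. f z * indicator (- cball 0 (s n)) z) \<in> borel_measurable lborel" for n
      using f by measurable
    show "AE z in lborel. f z * indicator (- cball 0 (s n)) z \<le> f z" for n
      by (auto simp: indicator_def)
    show "AE z in lborel. (\<lambda>n. f z * indicator (- cball 0 (s n)) z) \<longlonglongrightarrow> 0"
    proof (rule AE_I2)
      fix z :: complex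
      show "(\<lambda>n. f z * indicator (- cball 0 (s n)) z) \<longlonglongrightarrow> 0"
      proof (cases "norm z < 1")
        case True
        then have "\<forall>\<^sub>F n in sequentially. norm z < s n" using s order_tendstoD(1) by blast
        then have "\<forall>\<^sub>F n in sequentially. f z * indicator (- cball 0 (s n)) z = 0"
          by eventually_elim auto
        then show ?thesis by (rule tendsto_eventually)
      next
        case False
        then show ?thesis by (simp add: f_def)
      qed
    qed
  qed simp
  then have "\<forall>\<^sub>F n in sequentially. (\<integral>\<^sup>+z. f z * indicator (- cball 0 (s n)) z \<partial>lborel) < 1"
    by (rule order_tendstoD(2)) simp
  then obtain n where "(\<integral>\<^sup>+z. f z * indicator (- cball 0 (s n)) z \<partial>lborel) < 1"
    by (auto dest: eventually_happens)
  then show thesis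
    by (intro that[of "s n"]) (auto simp: s_def f_def field_simps)
qed

lemma norm_add_square_le: "(norm (a + b :: 'a::real_normed_vector))\<^sup>2 \<le> 2 * (norm a)\<^sup>2 + 2 * (norm b)\<^sup>2"
proof -
  have "(norm (a + b))\<^sup>2 \<le> (norm a + norm b)\<^sup>2" by (simp add: norm_triangle_ineq power_mono)
  also have "\<dots> \<le> 2 * (norm a)\<^sup>2 + 2 * (norm b)\<^sup>2"
    using sum_squares_bound[of "norm a" "norm b"] by (simp add: power2_sum)
  finally show ?thesis .
qed

text \<open>On \<open>cball 0 r\<close> the density of the sum is that of \<open>w\<close>. Outside,
  one copy of the doubled density of \<open>w\<close> belongs to its full energy and the other to
  the tail. The full energy of \<open>w\<close> thus keeps coefficient 1, so iteration gives linear
  and not exponential growth.\<close>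

lemma dirichlet_energy_add_le:
  assumes w: "C1_on (ball 0 1) w" and v: "C1_on (ball 0 1) v"
    and v0: "\<And>z. z \<in> cball 0 r \<Longrightarrow> z \<in> ball 0 1 \<Longrightarrow> grad v z = 0"
  shows "dirichlet_energy (\<lambda>z. w z + v z) \<le> dirichlet_energy w +
    (\<integral>\<^sup>+z. ennreal ((norm (grad w z))\<^sup>2) * indicator (ball 0 1) z * indicator (- cball 0 r) z \<partial>lborel)
    + 2 * dirichlet_energy v"
proof -
  define f where "f z = ennreal ((norm (grad w z))\<^sup>2) * indicator (ball 0 1) z" for z
  define g where "g z = ennreal ((norm (grad v z))\<^sup>2) * indicator (ball 0 1) z" for z
  have [measurable]: "f \<in> borel_measurable lborel" "g \<in> borel_measurable lborel"
    unfolding f_def g_def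
    by (rule borel_measurable_energy_density[OF w], rule borel_measurable_energy_density[OF v])
  have "dirichlet_energy (\<lambda>z. w z + v z)
      \<le> (\<integral>\<^sup>+z. f z + f z * indicator (- cball 0 r) z + 2 * g z \<partial>lborel)"
    unfolding dirichlet_energy_def
  proof (rule nn_integral_mono)
    fix z :: complex
    have *: "grad (\<lambda>z. w z + v z) z = grad w z + grad v z" if "z \<in> ball 0 1"
      by (intro grad_eq GDERIV_add C1_on_GDERIV[OF w that] C1_on_GDERIV[OF v that])
    show "ennreal ((norm (grad (\<lambda>z. w z + v z) z))\<^sup>2) * indicator (ball 0 1) z
      \<le> f z + f z * indicator (- cball 0 r) z + 2 * g z"
    proof (cases "z \<in> ball 0 1")
      case True
      show ?thesis
      proof (cases "z \<in> cball 0 r")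
        case in_cball: True
        show ?thesis using True in_cball v0[OF in_cball True] * by (simp add: f_def)
      next
        case False
        have "ennreal ((norm (grad w z + grad v z))\<^sup>2)
          \<le> ennreal ((norm (grad w z))\<^sup>2 + (norm (grad w z))\<^sup>2 + 2 * (norm (grad v z))\<^sup>2)"
          using norm_add_square_le[of "grad w z" "grad v z"] by (intro ennreal_leI) simp
        also have "\<dots> = f z + f z * indicator (- cball 0 r) z + 2 * g z"
          using True False by (simp add: f_def g_def ennreal_mult) (simp add: mult_2)
        finally show ?thesis using * True by simp
      qed
    qed simp
  qed
  also have "\<dots> = (\<integral>\<^sup>+z. f z \<partial>lborel) + (\<integral>\<^sup>+z. f z * indicator (- cball 0 r) z \<partial>lborel)
      + 2 * (\<integral>\<^sup>+z. g z \<partial>lborel)"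
    by (simp add: nn_integral_add nn_integral_cmult)
  finally show ?thesis unfolding f_def g_def dirichlet_energy_def .
qed

text \<open>Serves both the truncation by \<open>smooth_step\<close>, with \<open>c = 2\<close>, and
  the final scaling by a constant.\<close>

lemma dirichlet_energy_compose_le:
  assumes u: "C1_on (ball 0 1) u" and f: "\<And>t. DERIV f t :> f' t" and c: "\<And>t. \<bar>f' t\<bar> \<le> c"
  shows "dirichlet_energy (\<lambda>z. f (u z)) \<le> ennreal (c\<^sup>2) * dirichlet_energy u"
proof -
  have "dirichlet_energy (\<lambda>z. f (u z))
    \<le> (\<integral>\<^sup>+z. ennreal (c\<^sup>2) * (ennreal ((norm (grad u z))\<^sup>2) * indicator (ball 0 1) z) \<partial>lborel)"
    unfolding dirichlet_energy_def
  proof (rule nn_integral_mono)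
    fix z :: complex
    have "ennreal ((norm (grad (\<lambda>z. f (u z)) z))\<^sup>2) \<le> ennreal (c\<^sup>2) * ennreal ((norm (grad u z))\<^sup>2)"
      if z: "z \<in> ball 0 1"
    proof -
      have "grad (\<lambda>z. f (u z)) z = f' (u z) *\<^sub>R grad u z"
        by (intro grad_eq GDERIV_compose_DERIV C1_on_GDERIV[OF u z] f)
      moreover have "(f' (u z))\<^sup>2 \<le> c\<^sup>2" using c[of "u z"] by (simp add: abs_le_square_iff[symmetric])
      ultimately show ?thesis
        by (simp add: power_mult_distrib mult_right_mono ennreal_mult[symmetric] ennreal_leI)
    qed
    then show "ennreal ((norm (grad (\<lambda>z. f (u z)) z))\<^sup>2) * indicator (ball 0 1) z
      \<le> ennreal (c\<^sup>2) * (ennreal ((norm (grad u z))\<^sup>2) * indicator (ball 0 1) z)"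
      by (cases "z \<in> ball 0 1") auto
  qed
  also have "\<dots> = ennreal (c\<^sup>2) * dirichlet_energy u"
    unfolding dirichlet_energy_def
    by (rule nn_integral_cmult) (rule borel_measurable_energy_density[OF u])
  finally show ?thesis .
qed

section \<open>Competitors of low energy\<close>

lemma ex_truncated_competitor:
  assumes E: "E \<subseteq> sphere 0 1" and r: "r < 1" and cap: "condenser_cap E (cball 0 r) < K"
  obtains v where "C1_on (ball 0 1) v" "\<And>z. z \<in> cball 0 r \<Longrightarrow> v z = 0 \<and> grad v z = 0"
    "\<And>\<zeta>. \<zeta> \<in> E \<Longrightarrow> ((\<lambda>s. v (complex_of_real s * \<zeta>)) \<longlongrightarrow> 1) (at_left 1)"
    "dirichlet_energy v \<le> 4 * K"
proof -
  obtain u where adm: "admissible E (cball 0 r) u" and en: "dirichlet_energy u < K"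
    using cap unfolding condenser_cap_def by (auto simp: INF_less_iff)
  from adm have u: "C1_on (ball 0 1) u" by (simp add: admissible_def)
  \<comment> \<open>Truncation turns radial limits on \<open>E\<close>, possibly infinite, into
    exactly 1, so that limits of several competitors add up. As \<open>smooth_step\<close> and its
    derivative vanish at all nonpositive reals, \<open>v\<close> and its gradient vanish on all of
    \<open>cball 0 r\<close>, bounding circle included.\<close>
  define v where "v z = smooth_step (u z)" for z
  show thesis
  proof (rule that)
    show "C1_on (ball 0 1) v"
      unfolding v_def
      by (rule C1_on_compose_DERIV[OF u DERIV_smooth_step continuous_on_smooth_step'])
    show "v z = 0 \<and> grad v z = 0" if z: "z \<in> cball 0 r" for z
    proof -
      from z r have zb: "z \<in> ball 0 1" by simp
      from adm z have "disc_value u z \<le> 0" by (simp add: admissible_def)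
      with zb have "u z \<le> 0" by (simp add: disc_value_def)
      moreover have "grad v z = smooth_step' (u z) *\<^sub>R grad u z"
        unfolding v_def
        by (intro grad_eq GDERIV_compose_DERIV C1_on_GDERIV[OF u zb] DERIV_smooth_step)
      ultimately show ?thesis by (simp add: v_def smooth_step_nonpos smooth_step'_nonpos)
    qed
    show "((\<lambda>s. v (complex_of_real s * \<zeta>)) \<longlongrightarrow> 1) (at_left 1)" if \<zeta>: "\<zeta> \<in> E" for \<zeta>
    proof -
      from E \<zeta> have nb: "\<zeta> \<notin> ball 0 1" by auto
      with adm \<zeta> obtain L where L: "has_radial_limit u \<zeta> L" unfolding admissible_def by blast
      from adm \<zeta> have "disc_value u \<zeta> \<ge> 1" by (simp add: admissible_def)
      then have "L \<ge> 1" using disc_value_eq[OF L nb] by simp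
      then show ?thesis
        using L unfolding v_def has_radial_limit_def by (intro tendsto_smooth_step)
    qed
    have "dirichlet_energy v \<le> ennreal (2\<^sup>2) * dirichlet_energy u"
      unfolding v_def by (rule dirichlet_energy_compose_le[OF u DERIV_smooth_step abs_smooth_step'_le])
    also have "\<dots> \<le> 4 * K" using en by (simp add: mult_left_mono)
    finally show "dirichlet_energy v \<le> 4 * K" .
  qed
qed

text \<open>Each radius is chosen after the preceding sum is known. The increment
  \<open>1 + 8 * K\<close> consists of a tail of at most 1 and twice the energy \<open>4 * K\<close>
  of the new truncated competitor.\<close>

lemma ex_low_energy_sum:
  assumes E: "E \<subseteq> sphere 0 1" and K: "K < \<infinity>"
    and cap: "\<And>r. r < 1 \<Longrightarrow> condenser_cap E (cball 0 r) < K"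
  shows "\<exists>w. C1_on (ball 0 1) w \<and> (\<forall>z\<in>cball 0 (1/2). w z = 0) \<and>
    (\<forall>\<zeta>\<in>E. ((\<lambda>s. w (complex_of_real s * \<zeta>)) \<longlongrightarrow> real n) (at_left 1)) \<and>
    dirichlet_energy w \<le> of_nat n * (1 + 8 * K)"
proof (induction n)
  case 0
  have "C1_on (ball 0 1) (\<lambda>_. 0)" by (rule C1_onI[where g = "\<lambda>_. 0"]) (auto intro: GDERIV_const)
  moreover have "grad (\<lambda>_. 0) z = 0" for z by (rule grad_eq) (rule GDERIV_const)
  ultimately show ?case
    by (intro exI[of _ "\<lambda>_. 0"]) (auto simp: dirichlet_energy_def)
next
  case (Suc n)
  then obtain w where w: "C1_on (ball 0 1) w" "\<forall>z\<in>cball 0 (1/2). w z = 0"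
    "\<forall>\<zeta>\<in>E. ((\<lambda>s. w (complex_of_real s * \<zeta>)) \<longlongrightarrow> real n) (at_left 1)"
    "dirichlet_energy w \<le> of_nat n * (1 + 8 * K)" by blast
  \<comment> \<open>Dominated convergence needs finite energy of the sum built so far; this is where
    finiteness of \<open>K\<close> enters.\<close>
  have "of_nat n * (1 + 8 * K) < \<infinity>"
    using K by (auto simp: ennreal_mult_less_top of_nat_less_top)
  with w(4) have "dirichlet_energy w < \<infinity>" by (rule le_less_trans)
  with w(1) obtain r where r: "1/2 \<le> r" "r < 1"
    and tail: "(\<integral>\<^sup>+z. ennreal ((norm (grad w z))\<^sup>2) * indicator (ball 0 1) z * indicator (- cball 0 r) z \<partial>lborel) \<le> 1"
    by (rule energy_tail_small)
  from ex_truncated_competitor[OF E r(2) cap[OF r(2)]] obtain v where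
    v: "C1_on (ball 0 1) v" "\<And>z. z \<in> cball 0 r \<Longrightarrow> v z = 0 \<and> grad v z = 0"
    "\<And>\<zeta>. \<zeta> \<in> E \<Longrightarrow> ((\<lambda>s. v (complex_of_real s * \<zeta>)) \<longlongrightarrow> 1) (at_left 1)"
    "dirichlet_energy v \<le> 4 * K" by blast
  show ?case
  proof (intro exI[of _ "\<lambda>z. w z + v z"] conjI ballI)
    show "C1_on (ball 0 1) (\<lambda>z. w z + v z)" using w(1) v(1) by (rule C1_on_add)
    show "w z + v z = 0" if "z \<in> cball 0 (1/2)" for z
      using that w(2) v(2)[of z] r by auto
    show "((\<lambda>s. w (complex_of_real s * \<zeta>) + v (complex_of_real s * \<zeta>)) \<longlongrightarrow> real (Suc n)) (at_left 1)"
      if "\<zeta> \<in> E" for \<zeta>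
      using tendsto_add[OF w(3)[rule_format, OF that] v(3)[OF that]] by (simp add: add.commute)
    have "dirichlet_energy (\<lambda>z. w z + v z) \<le> dirichlet_energy w +
        (\<integral>\<^sup>+z. ennreal ((norm (grad w z))\<^sup>2) * indicator (ball 0 1) z * indicator (- cball 0 r) z \<partial>lborel)
        + 2 * dirichlet_energy v"
      using w(1) v(1,2) by (intro dirichlet_energy_add_le) auto
    also have "\<dots> \<le> of_nat n * (1 + 8 * K) + 1 + 2 * (4 * K)"
      by (intro add_mono mult_left_mono w(4) tail v(4)) simp
    also have "\<dots> = of_nat (Suc n) * (1 + 8 * K)"
      by (simp add: distrib_right add_ac mult.assoc[symmetric])
    finally show "dirichlet_energy (\<lambda>z. w z + v z) \<le> of_nat (Suc n) * (1 + 8 * K)" .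
  qed
qed

text \<open>Scaling the boundary value \<open>Suc n\<close> back to 1 divides the energy by its
  square, while the energy of the sum grows only linearly.\<close>

lemma circle_cap_eq_0:
  assumes E: "E \<subseteq> sphere 0 1" and K: "K < \<infinity>"
    and cap: "\<And>r. r < 1 \<Longrightarrow> condenser_cap E (cball 0 r) < K"
  shows "circle_cap E = 0"
proof -
  have bound: "circle_cap E \<le> ennreal (1 / real (Suc n)) * (1 + 8 * K)" for n
  proof -
    define c where "c = 1 / real (Suc n)"
    obtain w where w: "C1_on (ball 0 1) w" "\<forall>z\<in>cball 0 (1/2). w z = 0"
      "\<forall>\<zeta>\<in>E. ((\<lambda>s. w (complex_of_real s * \<zeta>)) \<longlongrightarrow> real (Suc n)) (at_left 1)"
      "dirichlet_energy w \<le> of_nat (Suc n) * (1 + 8 * K)"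
      using ex_low_energy_sum[OF E K cap, of "Suc n"] by blast
    have lim: "has_radial_limit (\<lambda>z. c * w z) \<zeta> 1" if "\<zeta> \<in> E" for \<zeta>
      using tendsto_mult_left[OF w(3)[rule_format, OF that], of c]
      by (simp add: has_radial_limit_def c_def one_ereal_def)
    have "admissible E (cball 0 (1/2)) (\<lambda>z. c * w z)"
      unfolding admissible_def
    proof (intro conjI ballI)
      show "C1_on (ball 0 1) (\<lambda>z. c * w z)" using w(1) by (rule C1_on_scale)
      show "\<exists>L. L \<noteq> - \<infinity> \<and> has_radial_limit (\<lambda>z. c * w z) \<zeta> L"
        if "\<zeta> \<in> E \<union> cball 0 (1/2) - ball 0 1" for \<zeta>
        \<comment> \<open>The disc of radius 1/2 lies inside the open unit disc, so only points of
          \<open>E\<close> remain.\<close>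
        using that lim[of \<zeta>] by (intro exI[of _ 1]) auto
      show "1 \<le> disc_value (\<lambda>z. c * w z) \<zeta>" if "\<zeta> \<in> E" for \<zeta>
        using disc_value_eq[OF lim[OF that]] E that by auto
      show "disc_value (\<lambda>z. c * w z) z \<le> 0" if "z \<in> cball 0 (1/2)" for z
        using that w(2) by (simp add: disc_value_def)
    qed
    then have "circle_cap E \<le> dirichlet_energy (\<lambda>z. c * w z)"
      unfolding circle_cap_def condenser_cap_def by (intro INF_lower) simp
    also have "\<dots> \<le> ennreal (c\<^sup>2) * dirichlet_energy w"
      by (rule dirichlet_energy_compose_le[OF w(1), where f = "\<lambda>t. c * t" and f' = "\<lambda>_. c"])
        (auto intro!: derivative_eq_intros simp: c_def)
    also have "\<dots> \<le> ennreal (c\<^sup>2) * (of_nat (Suc n) * (1 + 8 * K))"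
      by (intro mult_left_mono w(4)) simp
    also have "\<dots> = ennreal (c\<^sup>2 * real (Suc n)) * (1 + 8 * K)"
      by (simp only: ennreal_mult' ennreal_of_nat_eq_real_of_nat mult.assoc of_nat_0_le_iff)
        (simp add: ennreal_mult mult.assoc)
    also have "c\<^sup>2 * real (Suc n) = c" by (simp add: c_def power2_eq_square)
    finally show ?thesis unfolding c_def .
  qed
  have "(\<lambda>n. ennreal (1 / real (Suc n))) \<longlonglongrightarrow> ennreal 0"
    using LIMSEQ_inverse_real_of_nat by (intro tendsto_ennrealI) (simp add: inverse_eq_divide)
  then have "(\<lambda>n. ennreal (1 / real (Suc n)) * (1 + 8 * K)) \<longlonglongrightarrow> ennreal 0 * (1 + 8 * K)"
    \<comment> \<open>Finiteness of \<open>K\<close> excludes the product of 0 and infinity, at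
      which multiplication is not continuous.\<close>
    using K by (intro tendsto_mult_ennreal tendsto_const) (auto simp: ennreal_mult_eq_top_iff)
  then have "circle_cap E \<le> ennreal 0 * (1 + 8 * K)"
    using bound by (intro LIMSEQ_le_const) auto
  then show ?thesis by simp
qed

theorem theorem1:
  fixes E :: "complex set"
  assumes "closed E" and "E \<subseteq> sphere 0 1"
    and "circle_cap E > 0"
  shows "((\<lambda>r::real. condenser_cap E (cball 0 r)) \<longlongrightarrow> \<infinity>) (at_left 1)"
proof (rule order_tendstoI)
  \<comment> \<open>Nothing exceeds infinity, so only lower bounds on the capacity need an
    argument.\<close>
  fix M :: ennreal assume M: "M < \<infinity>"
  \<comment> \<open>Without such a radius all capacities would stay below the finite bound
    \<open>M + 1\<close>, forcing \<open>circle_cap E = 0\<close>. The added 1 turns the weak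
    inequality into a strict one for \<open>M\<close>.\<close>
  obtain r where r: "r < 1" "M + 1 \<le> condenser_cap E (cball 0 r)"
    using circle_cap_eq_0[OF assms(2), of "M + 1"] assms(3) M by force
  have "M < M + 1" using M by (cases M) (auto simp: ennreal_less_iff ennreal_plus[symmetric]
        ennreal_1[symmetric] simp del: ennreal_plus ennreal_1)
  \<comment> \<open>Monotonicity carries the bound from one radius to all larger ones.\<close>
  moreover have "condenser_cap E (cball 0 r) \<le> condenser_cap E (cball 0 s)" if "r < s" for s
    using that by (intro condenser_cap_mono) auto
  ultimately have "M < condenser_cap E (cball 0 s)" if "r < s" for s
    using r(2) that by (meson less_le_trans)
  then show "\<forall>\<^sub>F s in at_left 1. M < condenser_cap E (cball 0 s)"
    using eventually_at_left_real[OF r(1)] by (auto elim!: eventually_mono)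
qed simp

end
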